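(* For an ordered groupoid $(S,\cdot,\le)$ and a fuzzy subset $f$ of $S$, consider the following statements: (1) $f$ is fuzzy semiprime, that is, $f(x)\ge f(x^2)$ for every $x\in S$. (2) If $g$ is a fuzzy subset of $S$ such that $g\circ g\preceq f$, then $g\preceq f$. Then for every ordered groupoid $S$ and every fuzzy subset $f$ of $S$, (1) implies (2). The implication (2) $\Rightarrow$ (1) does not hold in general, that is, there exist an ordered groupoid $S$ and a fuzzy subset $f$ of $S$ for which (2) holds but (1) does not.
   Context: An ordered groupoid $(S,\cdot,\le)$ is a (partially) ordered set $(S,\le)$ endowed with a binary multiplication (not assumed associative) compatible with the order: $a\le b$ implies $ac\le bc$ and $ca\le cb$ for every $c\in S$. Write $x^2=x\cdot x$. A fuzzy subset of $S$ is a mapping $f:S\to[0,1]$ into the closed real unit interval. For $a\in S$ let $A_a=\{(x,y)\in S\times S \mid a\le xy\}$. For fuzzy subsets $f,g$ of $S$, the product $f\circ g$ is the fuzzy subset of $S$ given by $(f\circ g)(a)=\sup_{(x,y)\in A_a}\min\{f(x),g(y)\}$ if $A_a\neq\emptyset$, and $(f\circ g)(a)=0$ if $A_a=\emptyset$. The order on fuzzy subsets is: $f\preceq g$ if and only if $f(x)\le g(x)$ for all $x\in S$. *)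

theory Defs
  imports Complex_Main "HOL-Library.FuncSet"
begin

text \<open>The order of an ordered groupoid is the set of pairs \<open>r\<close>: \<open>a \<le> b\<close> is written
  \<open>(a, b) \<in> r\<close>. The multiplication \<open>m\<close> is only meaningful on the carrier \<open>S\<close>.\<close>

locale ordered_groupoid =
  fixes S :: "'a set" and m :: "'a \<Rightarrow> 'a \<Rightarrow> 'a" and r :: "'a rel"
  assumes order: "partial_order_on S r"
    and closed: "\<lbrakk>a \<in> S; b \<in> S\<rbrakk> \<Longrightarrow> m a b \<in> S"
    and mono_right: "\<lbrakk>(a, b) \<in> r; c \<in> S\<rbrakk> \<Longrightarrow> (m a c, m b c) \<in> r"
    and mono_left: "\<lbrakk>(a, b) \<in> r; c \<in> S\<rbrakk> \<Longrightarrow> (m c a, m c b) \<in> r"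

text \<open>Fuzzy subsets are not required to be extensional: their values outside \<open>S\<close> are never
  used by the notions below.\<close>

definition fuzzy_subset :: "'a set \<Rightarrow> ('a \<Rightarrow> real) \<Rightarrow> bool" where
  "fuzzy_subset S f \<longleftrightarrow> f \<in> S \<rightarrow> {0..1}"

definition fuzzy_le :: "'a set \<Rightarrow> ('a \<Rightarrow> real) \<Rightarrow> ('a \<Rightarrow> real) \<Rightarrow> bool" where
  "fuzzy_le S f g \<longleftrightarrow> (\<forall>x\<in>S. f x \<le> g x)"

definition factor_pairs :: "'a set \<Rightarrow> ('a \<Rightarrow> 'a \<Rightarrow> 'a) \<Rightarrow> 'a rel \<Rightarrow> 'a \<Rightarrow> ('a \<times> 'a) set" where
  "factor_pairs S m r a = {(x, y) \<in> S \<times> S. (a, m x y) \<in> r}"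

text \<open>The supremum is the conditionally complete one of the reals; for fuzzy subsets \<open>f\<close> and
  \<open>g\<close> it is only taken over a nonempty set of values in \<open>[0, 1]\<close>.\<close>

definition fuzzy_prod ::
    "'a set \<Rightarrow> ('a \<Rightarrow> 'a \<Rightarrow> 'a) \<Rightarrow> 'a rel \<Rightarrow> ('a \<Rightarrow> real) \<Rightarrow> ('a \<Rightarrow> real) \<Rightarrow> 'a \<Rightarrow> real" where
  "fuzzy_prod S m r f g a =
    (if factor_pairs S m r a = {} then 0
     else (SUP (x, y) \<in> factor_pairs S m r a. min (f x) (g y)))"

definition fuzzy_semiprime :: "'a set \<Rightarrow> ('a \<Rightarrow> 'a \<Rightarrow> 'a) \<Rightarrow> ('a \<Rightarrow> real) \<Rightarrow> bool" where
  "fuzzy_semiprime S m f \<longleftrightarrow> (\<forall>x\<in>S. f x \<ge> f (m x x))"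

end

theory Submission
  imports Defs
begin

text \<open>Everything rests on one inequality: if \<open>a \<le> x\<^sup>2\<close>, then the pair \<open>(x, x)\<close> takes part in the
  supremum that defines \<open>(g \<circ> g)(a)\<close>, so \<open>g(x) \<le> (g \<circ> g)(a)\<close>.

  With \<open>a = x\<^sup>2\<close> it gives \<open>g(x) \<le> (g \<circ> g)(x\<^sup>2) \<le> f(x\<^sup>2) \<le> f(x)\<close> for a fuzzy semiprime \<open>f\<close> with
  \<open>g \<circ> g \<preceq> f\<close>.

  The converse fails because the product tests \<open>f\<close> at every \<open>a\<close> below \<open>x\<^sup>2\<close>, and a fuzzy subset
  that is not antitone can be small at such an \<open>a\<close> although it is large at \<open>x\<^sup>2\<close>.
  On the chain \<open>0 < 1\<close> with every product equal to \<open>1\<close>, let \<open>f(0) = 0\<close> and \<open>f(1) = 1\<close>. Then \<open>f\<close> is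
  not fuzzy semiprime at \<open>0\<close>. But \<open>0\<close> lies below every square, so \<open>g \<circ> g \<preceq> f\<close> forces
  \<open>g(x) \<le> f(0) = 0\<close> for all \<open>x\<close>.\<close>

text \<open>The bound \<open>f \<le> 1\<close> makes the supremum over the reals an actual upper bound of the minima.\<close>

lemma min_le_fuzzy_prod:
  assumes "fuzzy_subset S f" and xy: "x \<in> S" "y \<in> S" "(a, m x y) \<in> r"
  shows "min (f x) (g y) \<le> fuzzy_prod S m r f g a"
proof -
  let ?h = "\<lambda>(x, y). min (f x) (g y)"
  have mem: "(x, y) \<in> factor_pairs S m r a"
    using xy by (simp add: factor_pairs_def)
  have "bdd_above (?h ` factor_pairs S m r a)"
  proof (rule bdd_aboveI2)
    fix p assume "p \<in> factor_pairs S m r a"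
    then show "?h p \<le> 1"
      using assms(1) by (force simp: factor_pairs_def fuzzy_subset_def Pi_iff min_le_iff_disj)
  qed
  with mem have "?h (x, y) \<le> (SUP p \<in> factor_pairs S m r a. ?h p)"
    by (rule cSUP_upper)
  with mem show ?thesis
    by (auto simp: fuzzy_prod_def)
qed

corollary le_fuzzy_prod_self:
  assumes "fuzzy_subset S g" "x \<in> S" "(a, m x x) \<in> r"
  shows "g x \<le> fuzzy_prod S m r g g a"
  using min_le_fuzzy_prod[of S g x x a m r g] assms by simp

lemma (in ordered_groupoid) fuzzy_semiprime_imp_le:
  assumes "fuzzy_semiprime S m f" "fuzzy_subset S g" "fuzzy_le S (fuzzy_prod S m r g g) f"
  shows "fuzzy_le S g f"
  unfolding fuzzy_le_def
proof
  fix x assume x: "x \<in> S"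
  have sq: "m x x \<in> S"
    using x by (simp add: closed)
  then have "(m x x, m x x) \<in> r"
    using order by (simp add: partial_order_on_def preorder_on_def refl_on_def)
  with assms(2) x have "g x \<le> fuzzy_prod S m r g g (m x x)"
    by (rule le_fuzzy_prod_self)
  also have "\<dots> \<le> f (m x x)"
    using assms(3) sq by (simp add: fuzzy_le_def)
  also have "\<dots> \<le> f x"
    using assms(1) x by (simp add: fuzzy_semiprime_def)
  finally show "g x \<le> f x" .
qed

lemma not_fuzzy_semiprime_example:
  fixes S :: "nat set"
  defines "S \<equiv> {0, 1}" and "m \<equiv> \<lambda>_ _. 1" and "r \<equiv> {(0, 0), (0, 1), (1, 1)}"
    and "f \<equiv> real"
  shows "ordered_groupoid S m r" and "fuzzy_subset S f"
    and "\<lbrakk>fuzzy_subset S g; fuzzy_le S (fuzzy_prod S m r g g) f\<rbrakk> \<Longrightarrow> fuzzy_le S g f"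
    and "\<not> fuzzy_semiprime S m f"
proof -
  show "ordered_groupoid S m r"
    by unfold_locales
      (auto simp: S_def m_def r_def partial_order_on_def preorder_on_def refl_on_def
        trans_def antisym_def)
  show "fuzzy_subset S f"
    by (simp add: S_def f_def fuzzy_subset_def)
  show "\<not> fuzzy_semiprime S m f"
    by (simp add: S_def m_def f_def fuzzy_semiprime_def)
  assume g: "fuzzy_subset S g" and le: "fuzzy_le S (fuzzy_prod S m r g g) f"
  have "g x \<le> f x" if x: "x \<in> S" for x
  proof -
    have "(0, m x x) \<in> r"
      by (simp add: m_def r_def)
    with g x have "g x \<le> fuzzy_prod S m r g g 0"
      by (rule le_fuzzy_prod_self)
    also have "\<dots> \<le> f 0"
      using le by (simp add: fuzzy_le_def S_def)
    also have "\<dots> \<le> f x"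
      by (simp add: f_def)
    finally show ?thesis .
  qed
  then show "fuzzy_le S g f"
    by (simp add: fuzzy_le_def)
qed

theorem theorem4:
  "(\<forall>(S :: 'a set) m r f.
      ordered_groupoid S m r \<and> fuzzy_subset S f \<longrightarrow>
      fuzzy_semiprime S m f \<longrightarrow>
      (\<forall>g. fuzzy_subset S g \<longrightarrow> fuzzy_le S (fuzzy_prod S m r g g) f \<longrightarrow> fuzzy_le S g f)) \<and>
   (\<exists>(S :: nat set) m r f.
      ordered_groupoid S m r \<and> fuzzy_subset S f \<and>
      (\<forall>g. fuzzy_subset S g \<longrightarrow> fuzzy_le S (fuzzy_prod S m r g g) f \<longrightarrow> fuzzy_le S g f) \<and>
      \<not> fuzzy_semiprime S m f)"
proof (intro conjI allI impI exI)
  fix S :: "'a set" and m r f g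
  assume "ordered_groupoid S m r \<and> fuzzy_subset S f" "fuzzy_semiprime S m f"
    "fuzzy_subset S g" "fuzzy_le S (fuzzy_prod S m r g g) f"
  then show "fuzzy_le S g f"
    by (blast intro: ordered_groupoid.fuzzy_semiprime_imp_le)
qed (fact not_fuzzy_semiprime_example)+

end
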